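(* Let $n\ge3$ be odd. Set $y=\binom{x}{2}$ and $u=x(x-1)$, and let $'$ denote differentiation with respect to $x$. Then Faulhaber's equations $$S_n(x)=y^2F_n(y)\qquad\text{and}\qquad S_{n-1}(x)=\tfrac13\,(y^2)'\,F_{n-1}(y)$$ (which are the defining equations of the Faulhaber polynomials $F_n$ and $F_{n-1}$) are each equivalent to the relations $$\frac12\,\frac{\mathbf{B}_n(x)}{x-\frac12}=\mathbf{F}_n(u)\qquad\text{and}\qquad\mathbf{B}_n(x)=u'\,\mathbf{F}_n(u),$$ where $$\mathbf{F}_n(u)=\sum_{k\ge0}(-1)^k\boldsymbol{f}_{n,k}\,u^k\qquad\text{and}\qquad\boldsymbol{f}_{n,k}=[x^k]\,\mathfrak{B}_{n,2k}(x)=\frac{1}{k!}\,\mathcal{B}_{n,2k}^{(k)}(1)\quad(k\ge0).$$ Moreover, for $0\le k\le n$, $$\boldsymbol{f}_{n,k}=\sum_{\nu=0}^{k}\binom{2k-n}{k-\nu}\mathfrak{B}_{n,\nu}=-\sum_{\nu=0}^{k}\binom{2k-\nu}{k}\binom{n}{\nu}\mathbf{B}_{n-\nu}.$$ In particular, $\boldsymbol{f}_{n,k}=0$ for $k=0$ and for $k\ge(n+1)/2$; otherwise (i.e. for $1\le k\le(n-1)/2$) one has $(-1)^{(n-1)/2}\boldsymbol{f}_{n,k}>0$. Hence $\deg\mathbf{F}_n=(n-1)/2$ and $\mathbf{F}_n(0)=0$.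
   Context: Bernoulli polynomials: $\frac{te^{xt}}{e^t-1}=\sum_{n\ge0}\mathbf{B}_n(x)\frac{t^n}{n!}$, and $\mathbf{B}_n=\mathbf{B}_n(0)$ (so $\mathbf{B}_1=-\frac12$). Power sums: $S_n(x)=\frac{1}{n+1}(\mathbf{B}_{n+1}(x)-\mathbf{B}_{n+1})$, so that $S_n(m)=\sum_{\nu=0}^{m-1}\nu^n$; in particular $S_1(x)=\binom{x}{2}=x(x-1)/2$ and $S_2(x)=\frac13(y^2)'$ with $y=\binom{x}{2}$. Faulhaber polynomials (classical Faulhaber–Jacobi theorem): for each $n\ge2$ there is a unique polynomial $F_n\in\mathbb{Q}[y]$, of degree $\lfloor n/2\rfloor-1$, such that $S_n(x)=S_2(x)\,F_n(S_1(x))$ if $n$ is even and $S_n(x)=S_1(x)^2\,F_n(S_1(x))$ if $n$ is odd. Generalized reciprocal Bernoulli polynomials: $\mathcal{B}_{n,k}(x)=x^k\,\mathbf{B}_n(x^{-1})$ for $n\ge0$, $k\in\mathbb{Z}$; $\mathcal{B}_{n,k}^{(\ell)}$ denotes the $\ell$-th derivative in $x$. The numbers $\mathfrak{B}_{n,k}=\sum_{\nu=k}^{n}\binom{n}{\nu}\binom{\nu}{k}\mathbf{B}_\nu$ ($0\le k\le n$) define the polynomial $\mathfrak{B}_n(x)=\sum_{k=0}^{n}\mathfrak{B}_{n,k}\,x^k$, and (to be distinguished from the numbers $\mathfrak{B}_{n,k}$) the formal power series $$\mathfrak{B}_{n,k}(x)=\mathfrak{B}_n(x)\,(x+1)^{k-n}=\mathfrak{B}_n(x)\sum_{\nu\ge0}\binom{k-n}{\nu}x^\nu\qquad(n\ge0,\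 k\in\mathbb{Z}).$$ $[x^k]f(x)$ denotes the coefficient of $x^k$ in the formal power series $f$. Binomial coefficients $\binom{a}{j}=a(a-1)\cdots(a-j+1)/j!$ are allowed with negative integer upper argument. *)

theory Defs
  imports "HOL-Analysis.Analysis" "HOL-Computational_Algebra.Computational_Algebra"
begin

text \<open>
  The Bernoulli polynomials are the polynomials over the rationals whose values at every
  rational \<open>x\<close> are the coefficients of \<open>t e^(x t) / (e^t - 1)\<close>, taken as a formal power
  series in \<open>t\<close>. The division is exact, since \<open>e^t - 1\<close> has order 1.
  A polynomial is determined by its values at all rationals, so \<open>THE\<close> is well defined;
  existence is \<open>poly_bernoulli_poly\<close> below.
\<close>

definition bernoulli_gf :: "rat \<Rightarrow> rat fps" where
  "bernoulli_gf x = fps_X * fps_exp x / (fps_exp 1 - 1)"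

definition bernoulli_poly :: "nat \<Rightarrow> rat poly" where
  "bernoulli_poly n = (THE p. \<forall>x. poly p x = fact n * fps_nth (bernoulli_gf x) n)"

definition bernoulli_num :: "nat \<Rightarrow> rat" where
  "bernoulli_num n = poly (bernoulli_poly n) 0"

definition power_sum_poly :: "nat \<Rightarrow> rat poly" where
  "power_sum_poly n =
     smult (1 / of_nat (n + 1)) (bernoulli_poly (n + 1) - [:bernoulli_num (n + 1):])"

definition faulhaber :: "nat \<Rightarrow> rat poly" where
  "faulhaber n = (THE F. degree F = n div 2 - 1 \<and>
     power_sum_poly n =
       (if even n then power_sum_poly 2 else (power_sum_poly 1)\<^sup>2) * pcompose F (power_sum_poly 1))"

text \<open>
  The generalized reciprocal Bernoulli polynomials (Laurent polynomials if \<open>k < n\<close>) as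
  functions of a real variable, so that their derivatives are the analytic ones. The value at
  \<open>x = 0\<close> is a junk value; derivatives are only taken at \<open>x = 1\<close>.
\<close>

definition recip_bernoulli :: "nat \<Rightarrow> int \<Rightarrow> real \<Rightarrow> real" where
  "recip_bernoulli n k x = x powi k * poly (map_poly of_rat (bernoulli_poly n)) (inverse x)"

definition frakB_num :: "nat \<Rightarrow> nat \<Rightarrow> rat" where
  "frakB_num n k = (\<Sum>\<nu>=k..n. of_nat (n choose \<nu>) * of_nat (\<nu> choose k) * bernoulli_num \<nu>)"

definition frakB_poly :: "nat \<Rightarrow> rat poly" where
  "frakB_poly n = (\<Sum>k\<le>n. monom (frakB_num n k) k)"

text \<open>\<open>fps_binomial a\<close> is the binomial series \<open>(1 + x)^a\<close>.\<close>

definition frakB_fps :: "nat \<Rightarrow> int \<Rightarrow> rat fps" where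
  "frakB_fps n k = fps_of_poly (frakB_poly n) * fps_binomial (of_int (k - int n))"

definition bf :: "nat \<Rightarrow> nat \<Rightarrow> rat" where
  "bf n k = fps_nth (frakB_fps n (2 * int k)) k"

text \<open>
  \<open>Abs_poly\<close> yields the polynomial with the given coefficients when almost all of them vanish
  (and is unspecified otherwise).
\<close>

definition bF :: "nat \<Rightarrow> rat poly" where
  "bF n = Abs_poly (\<lambda>k. (- 1) ^ k * bf n k)"

lemma poly_bernoulli_poly: "poly (bernoulli_poly n) x = fact n * fps_nth (bernoulli_gf x) n"
proof -
  define b :: "rat fps" where "b = fps_X / (fps_exp 1 - 1)"
  have nz: "fps_exp 1 - 1 \<noteq> (0 :: rat fps)"
  proof
    assume "fps_exp 1 - 1 = (0 :: rat fps)"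
    then have "fps_nth (fps_exp 1 - 1 :: rat fps) 1 = 0" by simp
    then show False by simp
  qed
  have sd: "subdegree (fps_exp 1 - 1 :: rat fps) = 1"
    by (rule subdegreeI) auto
  have dvd: "(fps_exp 1 - 1 :: rat fps) dvd fps_X"
    using nz sd by (simp add: fps_dvd_iff)
  have gf: "bernoulli_gf y = fps_exp y * b" for y
    unfolding bernoulli_gf_def b_def using dvd by (simp add: div_mult_swap mult.commute)
  define p where "p = (\<Sum>i\<le>n. monom (fact n * (1 / fact i) * fps_nth b (n - i)) i)"
  have p: "poly p y = fact n * fps_nth (bernoulli_gf y) n" for y
  proof -
    have "fps_nth (bernoulli_gf y) n = (\<Sum>i\<le>n. y ^ i / fact i * fps_nth b (n - i))"
      by (simp only: gf fps_mult_nth atLeast0AtMost) simp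
    then show ?thesis
      by (simp add: p_def poly_sum poly_monom sum_distrib_left mult_ac)
  qed
  have "\<forall>x. poly (bernoulli_poly n) x = fact n * fps_nth (bernoulli_gf x) n"
    unfolding bernoulli_poly_def
  proof (rule theI[of _ p])
    show "q = p" if "\<forall>x. poly q x = fact n * fps_nth (bernoulli_gf x) n" for q
      using that p by (simp add: poly_eq_poly_eq_iff[symmetric] fun_eq_iff)
  qed (use p in auto)
  then show ?thesis by blast
qed

end

(* For odd n >= 3 the reflection B_n(1 - x) = - B_n(x) makes B_n divisible by u' = 2 x - 1 with a
   quotient symmetric about 1/2, so B_n = u' F(u) for a unique polynomial F; likewise S_n = G(u) with
   G' = F, which gives the Faulhaber polynomials. Substituting x = 1/(1 + X) turns u into
   - X / (1 + X)^2, and f_{n,k} = [X^k] (1 + X)^(2k) B_n(1/(1 + X)). A term c u^j of F contributes to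
   this coefficient (-1)^j c times [X^(k-j)] (1 - X) (1 + X)^(2(k-j)-1), which vanishes unless j = k;
   so F has the coefficients (-1)^k f_{n,k}. Positivity follows from
   (1 + 4u) F_n'' + 6 F_n' = n (n - 1) F_{n-2}. *)

theory Submission
  imports Defs
begin

section \<open>Generating function and basic properties of the Bernoulli polynomials\<close>

lemma fps_exp_1_minus_1_nz: "fps_exp 1 - 1 \<noteq> (0 :: 'a :: field_char_0 fps)"
  by simp

lemma bernoulli_gf_mult: "bernoulli_gf x * (fps_exp 1 - 1) = fps_X * fps_exp x"
proof -
  have "subdegree (fps_exp 1 - 1 :: rat fps) = 1"
    by (rule subdegreeI) auto
  then have "(fps_exp 1 - 1 :: rat fps) dvd fps_X"
    by (simp add: fps_dvd_iff)
  then have "(fps_exp 1 - 1 :: rat fps) dvd fps_X * fps_exp x"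
    by simp
  then show ?thesis
    unfolding bernoulli_gf_def by (rule dvd_div_mult_self)
qed

lemma bernoulli_gf_eqI:
  assumes "f * (fps_exp 1 - 1) = fps_X * fps_exp x"
  shows "bernoulli_gf x = f"
  using assms bernoulli_gf_mult[of x] fps_exp_1_minus_1_nz by (metis mult_right_cancel)

lemma bernoulli_gf_eq_exp: "bernoulli_gf x = fps_exp x * bernoulli_gf 0"
  by (rule bernoulli_gf_eqI) (simp only: mult.assoc bernoulli_gf_mult, simp)

text \<open>Replacing t by -t in t e^(xt) / (e^t - 1) and extending the fraction by e^t gives t
  e^((1-x)t) / (e^t - 1).\<close>

lemma bernoulli_gf_reflect:
  "bernoulli_gf (1 - x) = bernoulli_gf x oo (fps_const (-1) * fps_X)"
proof (rule bernoulli_gf_eqI)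
  let ?m = "fps_const (-1) * fps_X :: rat fps"
  have m0: "?m $ 0 = 0" by simp
  have "(bernoulli_gf x * (fps_exp 1 - 1)) oo ?m = (fps_X * fps_exp x) oo ?m"
    by (simp only: bernoulli_gf_mult)
  then have *: "(bernoulli_gf x oo ?m) * (fps_exp (-1) - 1) = - fps_X * fps_exp (-x)"
    unfolding fps_compose_mult_distrib[OF m0] fps_compose_sub_distrib fps_exp_compose_linear
      fps_X_fps_compose_startby0[OF m0]
    by (simp flip: fps_const_neg)
  have e: "fps_exp 1 * fps_exp (-1) = (1 :: rat fps)" "fps_exp (-x) * fps_exp 1 = fps_exp (1 - x)"
    by (simp_all flip: fps_exp_add_mult)
  have "(bernoulli_gf x oo ?m) * (fps_exp 1 - 1)
      = - ((bernoulli_gf x oo ?m) * (fps_exp (-1) - 1)) * fps_exp 1"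
    using e(1) by algebra
  also have "\<dots> = fps_X * fps_exp (1 - x)"
    unfolding * by (simp add: mult.assoc e(2))
  finally show "(bernoulli_gf x oo ?m) * (fps_exp 1 - 1) = fps_X * fps_exp (1 - x)" .
qed

lemma bernoulli_num_eq: "bernoulli_num n = fact n * fps_nth (bernoulli_gf 0) n"
  by (simp add: bernoulli_num_def poly_bernoulli_poly)

text \<open>The factor e^(xt) splits off the generating function; the Cauchy product with the series
  at 0 produces the binomial coefficients.\<close>

lemma bernoulli_poly_altdef:
  "bernoulli_poly n = (\<Sum>i\<le>n. monom (of_nat (n choose i) * bernoulli_num (n - i)) i)"
proof -
  have "poly (bernoulli_poly n) x
      = poly (\<Sum>i\<le>n. monom (of_nat (n choose i) * bernoulli_num (n - i)) i) x" for x
  proof -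
    have "fact n * fps_nth (bernoulli_gf x) n
        = (\<Sum>i\<le>n. fact n * (x ^ i / fact i * fps_nth (bernoulli_gf 0) (n - i)))"
      by (subst bernoulli_gf_eq_exp) (simp add: fps_mult_nth atLeast0AtMost sum_distrib_left)
    also have "\<dots> = (\<Sum>i\<le>n. of_nat (n choose i) * bernoulli_num (n - i) * x ^ i)"
      by (rule sum.cong) (auto simp: bernoulli_num_eq binomial_fact field_simps)
    finally show ?thesis
      by (simp add: poly_bernoulli_poly poly_sum poly_monom)
  qed
  then show ?thesis
    by (simp add: poly_eq_poly_eq_iff[symmetric] fun_eq_iff)
qed

lemma coeff_bernoulli_poly:
  "coeff (bernoulli_poly n) i = of_nat (n choose i) * bernoulli_num (n - i)"
  by (auto simp: bernoulli_poly_altdef coeff_sum binomial_eq_0)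

lemma pderiv_bernoulli_poly:
  "pderiv (bernoulli_poly n) = smult (of_nat n) (bernoulli_poly (n - 1))"
proof (cases n)
  case 0
  then show ?thesis
    by (simp add: bernoulli_poly_altdef monom_0)
next
  case (Suc m)
  have "of_nat (Suc i) * (of_nat (Suc m choose Suc i) * b) = of_nat (Suc m) * (of_nat (m choose i) * b)"
    for i and b :: rat
    by (simp only: mult.assoc[symmetric] of_nat_mult[symmetric] Suc_times_binomial)
  then show ?thesis
    unfolding Suc
    by (intro poly_eqI)
       (simp only: coeff_pderiv coeff_smult coeff_bernoulli_poly diff_Suc_Suc diff_Suc_1)
qed

lemma bernoulli_poly_reflect:
  "pcompose (bernoulli_poly n) [:1, -1:] = smult ((- 1) ^ n) (bernoulli_poly n)"
proof -
  have "poly (pcompose (bernoulli_poly n) [:1, -1:]) x = poly (smult ((- 1) ^ n) (bernoulli_poly n)) x"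
    for x
    by (simp add: poly_pcompose poly_bernoulli_poly bernoulli_gf_reflect fps_compose_linear)
  then show ?thesis
    by (simp add: poly_eq_poly_eq_iff[symmetric] fun_eq_iff)
qed

text \<open>The series t e^t / (e^t - 1) and t / (e^t - 1) differ by exactly t, so only the
  coefficient at index 1 changes.\<close>

lemma bernoulli_poly_1:
  "poly (bernoulli_poly n) 1 = bernoulli_num n + (if n = 1 then 1 else 0)"
proof -
  have "bernoulli_gf 1 = bernoulli_gf 0 + fps_X"
    by (rule bernoulli_gf_eqI, simp only: distrib_right bernoulli_gf_mult) (simp add: algebra_simps)
  then show ?thesis
    by (simp add: bernoulli_num_def poly_bernoulli_poly distrib_left)
qed

lemma bernoulli_num_small:
  "bernoulli_num 0 = 1" "bernoulli_num (Suc 0) = - 1 / 2" "bernoulli_num 2 = 1 / 6"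
proof -
  note s = poly_sum poly_monom atMost_Suc numeral_2_eq_2 numeral_3_eq_3
  \<comment> \<open>When B_m(1) is expanded in \<open>bernoulli_poly_1\<close>, the number B_m
    cancels, so m = 1, 2, 3 determine B_0, B_1, B_2 in turn.\<close>
  have "bernoulli_num 1 + bernoulli_num 0 = bernoulli_num 1 + 1"
    using bernoulli_poly_1[of 1] unfolding bernoulli_poly_altdef by (simp add: s)
  then show 0: "bernoulli_num 0 = 1" by simp
  have "bernoulli_num 2 + 2 * bernoulli_num 1 + bernoulli_num 0 = bernoulli_num 2"
    using bernoulli_poly_1[of 2] unfolding bernoulli_poly_altdef by (simp add: s)
  then show 1: "bernoulli_num (Suc 0) = - 1 / 2" using 0 by simp
  have "bernoulli_num 3 + 3 * bernoulli_num 2 + 3 * bernoulli_num 1 + bernoulli_num 0 = bernoulli_num 3"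
    using bernoulli_poly_1[of 3] unfolding bernoulli_poly_altdef by (simp add: s)
  then show "bernoulli_num 2 = 1 / 6" using 0 1 by simp
qed

lemma degree_bernoulli_poly: "degree (bernoulli_poly n) = n"
proof (rule antisym)
  show "degree (bernoulli_poly n) \<le> n"
    by (rule degree_le) (simp add: coeff_bernoulli_poly)
  show "n \<le> degree (bernoulli_poly n)"
    by (rule le_degree) (simp add: coeff_bernoulli_poly bernoulli_num_small)
qed

text \<open>Reflection at 0 gives B_n(1) = - B_n, while B_n(1) = B_n for n different from 1.\<close>

lemma bernoulli_num_odd:
  assumes "odd n" "n \<noteq> 1"
  shows "bernoulli_num n = 0"
proof -
  have "poly (pcompose (bernoulli_poly n) [:1, -1:]) 0 = - bernoulli_num n"
    using assms by (simp only: bernoulli_poly_reflect) (simp add: bernoulli_num_def)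
  then show ?thesis
    using assms bernoulli_poly_1[of n] by (simp add: poly_pcompose)
qed

section \<open>Polynomials symmetric or antisymmetric about 1/2\<close>

text \<open>Induction on the degree: p - p(0) vanishes at 0, hence by symmetry at 1, so x (x - 1)
  divides it. As x (x - 1) is itself symmetric, so is the quotient, whose degree is smaller by
  2.\<close>

lemma symmetric_poly_imp_pcompose:
  fixes p :: "rat poly"
  assumes "pcompose p [:1, -1:] = p"
  shows "\<exists>q. p = pcompose q [:0, -1, 1:]"
  using assms
proof (induction "degree p" arbitrary: p rule: less_induct)
  case less
  let ?c = "poly p 0"
  show ?case
  proof (cases "degree p = 0")
    case True
    then obtain c where "p = [:c:]" by (rule degree_eq_zeroE)
    then show ?thesis by (intro exI[of _ "[:c:]"]) simp
  next
    case False
    have "poly (p - [:?c:]) 0 = 0" by simp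
    then obtain s where s: "p - [:?c:] = [:0, 1:] * s"
      unfolding poly_eq_0_iff_dvd by auto
    have "poly (pcompose p [:1, -1:]) 0 = poly p 1" by (simp add: poly_pcompose)
    then have "poly p 1 = ?c" by (simp only: less.prems)
    then have "poly ([:0, 1:] * s) 1 = 0" unfolding s[symmetric] by simp
    then have "poly s 1 = 0" by simp
    then obtain r where r: "s = [:-1, 1:] * r"
      unfolding poly_eq_0_iff_dvd by auto
    have pc: "p - [:?c:] = [:0, -1, 1:] * r"
      unfolding s r mult.assoc[symmetric] by simp
    then have p: "p = [:?c:] + [:0, -1, 1:] * r" by (simp only: diff_eq_eq add.commute)
    have "[:0, -1, 1:] * pcompose r [:1, -1:] = pcompose (p - [:?c:]) [:1, -1:]"
      by (simp only: pc pcompose_mult) (simp add: pcompose_pCons)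
    also have "\<dots> = [:0, -1, 1:] * r"
      by (simp only: pcompose_diff less.prems pcompose_const) (simp only: pc)
    finally have sym: "pcompose r [:1, -1:] = r" by (simp only: mult_cancel_left) simp
    have "r \<noteq> 0" using False p by (metis add.right_neutral degree_pCons_0 mult_zero_right)
    then have "degree ([:0, -1, 1:] * r) = degree r + 2"
      by (subst degree_mult_eq) simp_all
    then have "degree ([:?c:] + [:0, -1, 1:] * r) = degree r + 2"
      by (subst degree_add_eq_right) (simp_all del: mult_pCons_left)
    then have "degree p = degree r + 2" by (subst p)
    then have "degree r < degree p" by simp
    then obtain q where "r = pcompose q [:0, -1, 1:]"
      using less.hyps sym by blast
    then have "p = pcompose (pCons ?c q) [:0, -1, 1:]"
      using p by (simp add: pcompose_pCons)
    then show ?thesis ..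
  qed
qed

text \<open>Antisymmetry forces the root 1/2; dividing by 2 x - 1, itself antisymmetric, leaves a
  symmetric quotient.\<close>

lemma antisymmetric_poly_imp_pcompose:
  fixes p :: "rat poly"
  assumes "pcompose p [:1, -1:] = - p"
  shows "\<exists>q. p = [:-1, 2:] * pcompose q [:0, -1, 1:]"
proof -
  have "poly (pcompose p [:1, -1:]) (1/2) = poly p (1/2)" by (simp add: poly_pcompose)
  then have "poly p (1/2) = 0" by (simp add: assms)
  then obtain s where "p = [:-(1/2), 1:] * s"
    unfolding poly_eq_0_iff_dvd by auto
  then have "p = [:-1, 2:] * smult (1/2) s" by (simp add: smult_diff_right)
  then obtain t where p: "p = [:-1, 2:] * t" ..
  have "[:-1, 2:] * - pcompose t [:1, -1:] = pcompose [:-1, 2:] [:1, -1:] * pcompose t [:1, -1:]"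
    by (simp add: pcompose_pCons)
  also have "\<dots> = [:-1, 2:] * - t"
    using assms by (simp only: p pcompose_mult mult_minus_right)
  finally have "pcompose t [:1, -1:] = t"
    by (simp only: mult_cancel_left) simp
  from symmetric_poly_imp_pcompose[OF this] p show ?thesis by metis
qed

section \<open>Substitution of 1 / (1 + X) into polynomials\<close>

text \<open>The value of a polynomial at \<open>1 / (1 + X)\<close>, written as \<open>1 - X / (1 + X)\<close> because
  \<open>fps_compose\<close> is only meaningful for inner series without constant term.\<close>

definition fps_eval_inverse :: "rat poly \<Rightarrow> rat fps" where
  "fps_eval_inverse p = fps_of_poly (pcompose p [:1, -1:]) oo (fps_X * fps_binomial (-1))"

lemma fps_binomial_minus_1_mult: "fps_binomial (a :: 'a :: field_char_0) * (1 + fps_X) = fps_binomial (a + 1)"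
  by (simp add: fps_binomial_add_mult fps_binomial_1)

lemma fps_eval_inverse_add: "fps_eval_inverse (p + q) = fps_eval_inverse p + fps_eval_inverse q"
  by (simp add: fps_eval_inverse_def pcompose_add fps_of_poly_add fps_compose_add_distrib)

lemma fps_eval_inverse_mult: "fps_eval_inverse (p * q) = fps_eval_inverse p * fps_eval_inverse q"
  by (simp add: fps_eval_inverse_def pcompose_mult fps_of_poly_mult fps_compose_mult_distrib)

lemma fps_eval_inverse_const [simp]: "fps_eval_inverse [:c:] = fps_const c"
  by (simp add: fps_eval_inverse_def fps_of_poly_const)

lemma fps_eval_inverse_0 [simp]: "fps_eval_inverse 0 = 0"
  by (simp add: fps_eval_inverse_def)

lemma fps_eval_inverse_X: "fps_eval_inverse [:0, 1:] = fps_binomial (-1)"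
proof -
  have "fps_eval_inverse [:0, 1:] = 1 - fps_X * fps_binomial (-1)"
    by (simp add: fps_eval_inverse_def pcompose_pCons fps_of_poly_pCons fps_compose_sub_distrib
          flip: fps_const_neg)
  also have "\<dots> = fps_binomial (-1)"
    using fps_binomial_minus_1_mult[of "-1 :: rat"] by (simp add: algebra_simps)
  finally show ?thesis .
qed

lemma fps_eval_inverse_pCons:
  "fps_eval_inverse (pCons c p) = fps_const c + fps_binomial (-1) * fps_eval_inverse p"
proof -
  have "pCons c p = [:c:] + [:0, 1:] * p" by simp
  then show ?thesis
    by (simp only: fps_eval_inverse_add fps_eval_inverse_mult fps_eval_inverse_X fps_eval_inverse_const)
qed

lemma fps_eval_inverse_monom:
  "fps_eval_inverse (monom c i) = fps_const c * fps_binomial (- of_nat i)"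
proof (induction i)
  case (Suc i)
  have "fps_binomial (- of_nat (Suc i) :: rat) = fps_binomial (-1) * fps_binomial (- of_nat i)"
    by (simp flip: fps_binomial_add_mult)
  with Suc show ?case
    by (simp add: monom_Suc fps_eval_inverse_pCons)
qed (simp add: monom_0)

lemma fps_eval_inverse_sum: "fps_eval_inverse (sum f A) = (\<Sum>i\<in>A. fps_eval_inverse (f i))"
  by (induction A rule: infinite_finite_induct) (simp_all add: fps_eval_inverse_add)

section \<open>Formulas for the numbers f_{n,k}\<close>

lemma coeff_frakB_poly: "coeff (frakB_poly n) k = frakB_num n k"
  by (auto simp: frakB_poly_def coeff_sum frakB_num_def)

text \<open>The inner sums are binomial expansions of powers of 1 + X. The index is reversed so that
  \<open>i\<close> is the exponent of x in B_n; the whole is (1 + X)^n B_n(1 / (1 + X)).\<close>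

lemma fps_of_frakB_poly:
  "fps_of_poly (frakB_poly n)
     = (\<Sum>i\<le>n. fps_const (of_nat (n choose i) * bernoulli_num (n - i)) * fps_binomial (of_nat (n - i)))"
proof (rule fps_ext)
  fix k
  have "frakB_num n k = (\<Sum>i\<le>n. of_nat (n choose i) * of_nat (i choose k) * bernoulli_num i)"
    unfolding frakB_num_def by (rule sum.mono_neutral_left) (auto simp: binomial_eq_0)
  also have "\<dots> = (\<Sum>i\<le>n. of_nat (n choose (n - i)) * of_nat ((n - i) choose k) * bernoulli_num (n - i))"
    by (rule sum.reindex_bij_witness[of _ "\<lambda>i. n - i" "\<lambda>i. n - i"]) auto
  also have "\<dots> = (\<Sum>i\<le>n. of_nat (n choose i) * of_nat ((n - i) choose k) * bernoulli_num (n - i))"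
    by (rule sum.cong) (simp_all flip: binomial_symmetric)
  finally have *: "frakB_num n k = \<dots>" .
  show "fps_of_poly (frakB_poly n) $ k
      = (\<Sum>i\<le>n. fps_const (of_nat (n choose i) * bernoulli_num (n - i))
          * fps_binomial (of_nat (n - i))) $ k"
    by (simp add: coeff_frakB_poly * fps_sum_nth binomial_gbinomial mult_ac)
qed

text \<open>The exponents of 1 + X add up as (n - i) + (m - n) = m - i. Thus
  \<open>frakB_fps n m\<close> is the expansion of x^m B_n(1/x) at x = 1 + X.\<close>

lemma frakB_fps_eq_eval:
  "frakB_fps n m = fps_binomial (of_int m) * fps_eval_inverse (bernoulli_poly n)"
proof -
  have "fps_binomial (of_nat (n - i)) * fps_binomial (of_int (m - int n))
      = fps_binomial (of_int m) * fps_binomial (- of_nat i :: rat)" if "i \<le> n" for i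
    using that by (simp add: of_nat_diff flip: fps_binomial_add_mult)
  then show ?thesis
    unfolding frakB_fps_def fps_of_frakB_poly bernoulli_poly_altdef fps_eval_inverse_sum
      fps_eval_inverse_monom sum_distrib_left sum_distrib_right
    by (intro sum.cong) (simp_all add: mult.assoc mult.left_commute)
qed

text \<open>Expands B_n(1 / (1 + X)) monomial by monomial; this is the form that matches the
  derivatives at 1 in \<open>bf_eq_higher_deriv\<close>.\<close>

lemma bf_eq_gbinomial_sum:
  "bf n k = (\<Sum>i\<le>n. coeff (bernoulli_poly n) i * ((2 * of_nat k - of_nat i) gchoose k))"
proof -
  have "bf n k = (\<Sum>i\<le>n. (fps_const (coeff (bernoulli_poly n) i)
      * (fps_binomial (2 * of_nat k) * fps_binomial (- of_nat i))) $ k)"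
    unfolding bf_def frakB_fps_eq_eval
    by (subst bernoulli_poly_altdef)
       (simp add: fps_eval_inverse_sum fps_eval_inverse_monom sum_distrib_left fps_sum_nth
          coeff_bernoulli_poly mult.left_commute)
  also have "\<dots> = (\<Sum>i\<le>n. coeff (bernoulli_poly n) i * ((2 * of_nat k - of_nat i) gchoose k))"
    by (simp flip: fps_binomial_add_mult)
  finally show ?thesis .
qed

lemma bf_eq_frakB_num_sum:
  "bf n k = (\<Sum>\<nu>=0..k. (of_int (2 * int k - int n) gchoose (k - \<nu>)) * frakB_num n \<nu>)"
  unfolding bf_def frakB_fps_def fps_mult_nth
  by (intro sum.cong) (simp_all add: coeff_frakB_poly)

text \<open>For odd n the reflection replaces B_n(1 / (1 + X)) by - B_n(X / (1 + X)), because 1 - 1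
  / (1 + X) = X / (1 + X). The factor X^i then cuts the sum off at k.\<close>

lemma bf_eq_bernoulli_num_sum:
  assumes "odd n" "k \<le> n"
  shows "bf n k =
    - (\<Sum>\<nu>=0..k. of_nat ((2 * k - \<nu>) choose k) * of_nat (n choose \<nu>) * bernoulli_num (n - \<nu>))"
proof -
  define c where "c i = of_nat (n choose i) * bernoulli_num (n - i)" for i
  let ?w = "fps_X * fps_binomial (-1) :: rat fps"
  have "fps_eval_inverse (bernoulli_poly n) = fps_of_poly (- bernoulli_poly n) oo ?w"
    using assms(1) by (simp add: fps_eval_inverse_def bernoulli_poly_reflect)
  also have "\<dots> = - (\<Sum>i\<le>n. fps_const (c i) * (fps_X ^ i * fps_binomial (- of_nat i)))"
    unfolding bernoulli_poly_altdef c_def[symmetric]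
    by (simp add: fps_of_poly_uminus fps_compose_uminus fps_of_poly_sum fps_compose_sum_distrib
        fps_of_poly_monom fps_compose_mult_distrib fps_compose_power[symmetric] power_mult_distrib fps_binomial_power)
  finally have E: "fps_eval_inverse (bernoulli_poly n) = \<dots>" .
  have "bf n k = - (\<Sum>i\<le>n. (fps_const (c i) * (fps_X ^ i * (fps_binomial (2 * of_nat k) * fps_binomial (- of_nat i)))) $ k)"
    unfolding bf_def frakB_fps_eq_eval E
    by (simp add: sum_distrib_left fps_sum_nth mult.left_commute)
  also have "\<dots> = - (\<Sum>i\<le>n. if i \<le> k then c i * ((2 * of_nat k - of_nat i) gchoose (k - i)) else 0)"
    by (auto simp add: fps_X_power_mult_nth simp flip: fps_binomial_add_mult intro!: sum.cong)
  \<comment> \<open>Here \<open>k \<le> n\<close> ensures that every index up to \<open>k\<close>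
    occurs in the sum.\<close>
  also have "(\<Sum>i\<le>n. if i \<le> k then c i * ((2 * of_nat k - of_nat i) gchoose (k - i)) else 0)
      = (\<Sum>i=0..k. c i * ((2 * of_nat k - of_nat i) gchoose (k - i)))"
    using assms(2) by (intro sum.mono_neutral_cong_right) auto
  also have "\<dots> = (\<Sum>i=0..k. of_nat ((2 * k - i) choose k) * c i)"
  proof (rule sum.cong)
    fix i assume "i \<in> {0..k}"
    then have i: "i \<le> k" by simp
    have "(2 * of_nat k - of_nat i :: rat) = of_nat (2 * k - i)" using i by (simp add: of_nat_diff)
    then have "(2 * of_nat k - of_nat i) gchoose (k - i) = (of_nat ((2 * k - i) choose (k - i)) :: rat)"
      by (simp only: binomial_gbinomial)
    also have "(2 * k - i) choose (k - i) = (2 * k - i) choose k"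
      using i by (subst binomial_symmetric) (auto intro!: arg_cong2[where f = binomial])
    finally show "c i * ((2 * of_nat k - of_nat i) gchoose (k - i)) = of_nat ((2 * k - i) choose k) * c i"
      by simp
  qed simp
  finally show ?thesis by (simp add: c_def mult.assoc)
qed

section \<open>Reading off the coefficients of F from u' F(u)\<close>

text \<open>Induction along the Horner form a + u F(u). The factor u becomes - X (1 + X)^(-2), which
  lowers k by 1 and the exponent 2 k by 2, so the induction hypothesis applies at k - 1 with a
  change of sign.\<close>

lemma nth_fps_eval_inverse_deriv_pcompose:
  "(fps_binomial (2 * of_nat k) * fps_eval_inverse ([:-1, 2:] * pcompose F [:0, -1, 1:])) $ k
     = (-1) ^ k * coeff F k"
proof (induction F arbitrary: k)
  case 0
  then show ?case by simp
next
  case (pCons a F)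
  let ?b = "fps_binomial :: rat \<Rightarrow> rat fps"
  let ?E = "fps_eval_inverse"
  have u': "?E [:-1, 2:] = 2 * ?b (-1) - 1"
    by (simp add: fps_eval_inverse_pCons numeral_fps_const mult.commute flip: fps_const_neg)
  have "?E [:0, -1, 1:] = ?b (-1) * ?b (-1) - ?b (-1)"
    by (simp add: fps_eval_inverse_pCons algebra_simps flip: fps_const_neg)
  also have "?b (-1) * ?b (-1) = ?b (-2)"
    by (simp flip: fps_binomial_add_mult)
  also have "?b (-2) - ?b (-1) = - (fps_X * ?b (-2))"
    using fps_binomial_minus_1_mult[of "-2 :: rat"] by (simp add: algebra_simps)
  finally have u: "?E [:0, -1, 1:] = - (fps_X * ?b (-2))" .
  let ?P = "?E (pcompose F [:0, -1, 1:])"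
  have "?E ([:-1, 2:] * pcompose (pCons a F) [:0, -1, 1:])
      = (2 * ?b (-1) - 1) * (fps_const a - fps_X * ?b (-2) * ?P)"
    by (simp only: pcompose_pCons fps_eval_inverse_mult fps_eval_inverse_add u u'
        fps_eval_inverse_const) simp
  moreover have "?E ([:-1, 2:] * pcompose F [:0, -1, 1:]) = (2 * ?b (-1) - 1) * ?P"
    by (simp only: fps_eval_inverse_mult u')
  ultimately have "?b (2 * of_nat k) * ?E ([:-1, 2:] * pcompose (pCons a F) [:0, -1, 1:])
      = fps_const a * (2 * (?b (2 * of_nat k) * ?b (-1)) - ?b (2 * of_nat k))
        - fps_X * ((?b (2 * of_nat k) * ?b (-2)) * ?E ([:-1, 2:] * pcompose F [:0, -1, 1:]))"
    by (simp only:) (simp add: algebra_simps)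
  also have "\<dots> = fps_const a * (2 * ?b (2 * of_nat k - 1) - ?b (2 * of_nat k))
        - fps_X * (?b (2 * (of_nat k - 1)) * ?E ([:-1, 2:] * pcompose F [:0, -1, 1:]))"
    by (simp flip: fps_binomial_add_mult add: algebra_simps)
  finally have *: "?b (2 * of_nat k) * ?E ([:-1, 2:] * pcompose (pCons a F) [:0, -1, 1:]) = \<dots>" .
  show ?case
  proof (cases k)
    case 0
    then show ?thesis unfolding * by (simp add: numeral_fps_const)
  next
    case (Suc j)
    \<comment> \<open>The constant \<open>a\<close> contributes nothing for k > 0: absorption gives
      k binom(2k, k) = 2 k binom(2k - 1, k).\<close>
    have "of_nat k * (2 * (2 * of_nat k - 1 gchoose k) - (2 * of_nat k gchoose k)) = (0 :: rat)"
      using gbinomial_absorb_comp[of "2 * of_nat k :: rat" k] by (auto simp: algebra_simps)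
    then have "2 * (2 * of_nat k - 1 gchoose k) - (2 * of_nat k gchoose k) = (0 :: rat)"
      using Suc by auto
    then show ?thesis
      unfolding * using pCons.IH[of j] Suc by (simp add: numeral_fps_const)
  qed
qed

section \<open>The polynomial F_n for odd n\<close>

lemma pcompose_inject:
  fixes p q r :: "'a :: idom poly"
  assumes "pcompose p r = pcompose q r" "degree r > 0"
  shows "p = q"
  using assms pcompose_eq_0_iff[of r "p - q"] by (simp add: pcompose_diff)

lemma bernoulli_poly_odd_pcompose:
  assumes "odd n"
  shows "\<exists>F. bernoulli_poly n = [:-1, 2:] * pcompose F [:0, -1, 1:]"
  by (rule antisymmetric_poly_imp_pcompose) (use assms in \<open>simp add: bernoulli_poly_reflect\<close>)

lemma coeff_eq_bf:
  assumes "bernoulli_poly n = [:-1, 2:] * pcompose F [:0, -1, 1:]"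
  shows "coeff F k = (-1) ^ k * bf n k"
  using nth_fps_eval_inverse_deriv_pcompose[of k F]
  by (simp add: bf_def frakB_fps_eq_eval assms mult.assoc[symmetric] del: mult_pCons_left flip: power_add)

lemma bernoulli_poly_odd_eq_bF:
  assumes "odd n"
  shows "bernoulli_poly n = [:-1, 2:] * pcompose (bF n) [:0, -1, 1:]"
proof -
  obtain F where F: "bernoulli_poly n = [:-1, 2:] * pcompose F [:0, -1, 1:]"
    using bernoulli_poly_odd_pcompose[OF assms] ..
  \<comment> \<open>The sequence defining \<open>bF n\<close> is the coefficient sequence of an
    existing polynomial, so \<open>Abs_poly\<close> is applied within its domain and returns
    F.\<close>
  have "bF n = Abs_poly (coeff F)"
    unfolding bF_def by (rule arg_cong[where f = Abs_poly]) (simp add: coeff_eq_bf[OF F] fun_eq_iff)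
  with F show ?thesis by (simp add: coeff_inverse)
qed

lemma coeff_bF: "odd n \<Longrightarrow> coeff (bF n) k = (-1) ^ k * bf n k"
  by (rule coeff_eq_bf[OF bernoulli_poly_odd_eq_bF])

text \<open>Comparing degrees in B_n = u' F_n(u) gives n = 1 + 2 deg F_n.\<close>

lemma degree_bF:
  assumes "odd n"
  shows "degree (bF n) = (n - 1) div 2"
proof -
  have "pcompose (bF n) [:0, -1, 1:] \<noteq> 0"
    using degree_bernoulli_poly[of n] assms bernoulli_poly_odd_eq_bF[OF assms] odd_pos by fastforce
  then have "degree (bernoulli_poly n) = 1 + degree (bF n) * 2"
    by (subst bernoulli_poly_odd_eq_bF[OF assms], subst degree_mult_eq)
       (simp_all add: degree_pcompose)
  then show ?thesis by (simp add: degree_bernoulli_poly)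
qed

text \<open>At x = 0 the relation B_n = u' F_n(u) reads B_n(0) = - F_n(0), and the left side
  vanishes.\<close>

lemma coeff_bF_0:
  assumes "odd n" "n \<noteq> 1"
  shows "coeff (bF n) 0 = 0"
proof -
  have "poly (bernoulli_poly n) 0 = 0"
    using bernoulli_num_odd[OF assms] by (simp add: bernoulli_num_def)
  then show ?thesis
    unfolding bernoulli_poly_odd_eq_bF[OF assms(1)] by (simp add: poly_pcompose poly_0_coeff_0)
qed

section \<open>Differential equation and signs of f_{n,k}\<close>

text \<open>Comes from \<open>B\<^sub>n'' = n (n - 1) B\<^sub>n\<^sub>-\<^sub>2\<close>, using \<open>(u')\<^sup>2 = 1 + 4 u\<close>.\<close>

lemma bF_ODE:
  assumes "odd n" "n \<ge> 3"
  shows "[:1, 4:] * pderiv (pderiv (bF n)) + smult 6 (pderiv (bF n))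
    = smult (of_nat n * of_nat (n - 1)) (bF (n - 2))"
proof -
  let ?v = "[:-1, 2:] :: rat poly" and ?u = "[:0, -1, 1:] :: rat poly"
  let ?F = "bF n"
  have u': "pderiv ?u = ?v" and v': "pderiv ?v = 2" and vv: "pcompose [:1, 4:] ?u = ?v * ?v"
    by (simp_all add: pderiv_pCons pcompose_pCons numeral_poly)
  have six: "smult 6 p = 6 * p" for p :: "rat poly"
    by (simp add: numeral_poly)
  \<comment> \<open>With v' = 2 the first derivative is 2 F(u) + v^2 F'(u). The second collects 2 v
    F'(u) + 4 v F'(u), which is where the 6 comes from.\<close>
  have "pderiv (pderiv (?v * pcompose ?F ?u))
      = ?v * (?v * ?v * pcompose (pderiv (pderiv ?F)) ?u + 6 * pcompose (pderiv ?F) ?u)"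
    by (simp only: pderiv_mult pderiv_add pderiv_pcompose u' v' pderiv_numeral) algebra
  also have "\<dots> = ?v * pcompose ([:1, 4:] * pderiv (pderiv ?F) + smult 6 (pderiv ?F)) ?u"
    by (simp only: pcompose_add pcompose_mult pcompose_smult vv) (simp only: six)
  finally have "pderiv (pderiv (?v * pcompose ?F ?u)) = \<dots>" .
  moreover have "pderiv (pderiv (bernoulli_poly n))
      = smult (of_nat n * of_nat (n - 1)) (bernoulli_poly (n - 2))"
    by (simp add: pderiv_bernoulli_poly pderiv_smult numeral_2_eq_2)
  moreover have "bernoulli_poly (n - 2) = ?v * pcompose (bF (n - 2)) ?u"
    using assms by (intro bernoulli_poly_odd_eq_bF) auto
  ultimately have "?v * pcompose ([:1, 4:] * pderiv (pderiv ?F) + smult 6 (pderiv ?F)) ?u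
      = ?v * pcompose (smult (of_nat n * of_nat (n - 1)) (bF (n - 2))) ?u"
    by (simp only: bernoulli_poly_odd_eq_bF[OF assms(1), symmetric] pcompose_smult mult_smult_right)
  then have "pcompose ([:1, 4:] * pderiv (pderiv ?F) + smult 6 (pderiv ?F)) ?u
      = pcompose (smult (of_nat n * of_nat (n - 1)) (bF (n - 2))) ?u"
    by (simp only: mult_cancel_left) simp
  then show ?thesis by (rule pcompose_inject) simp
qed

text \<open>Comparison of coefficients at u^k in \<open>bF_ODE\<close>: 4 k (k + 1) and 6 (k + 1)
  combine to (k + 1) (4 k + 6), and the common factor k + 1 is divided out.\<close>

lemma bf_recurrence:
  assumes "odd n" "n \<ge> 3"
  shows "of_nat (4 * k + 6) * bf n (Suc k)
    = of_nat (k + 2) * bf n (Suc (Suc k)) - of_nat n * of_nat (n - 1) / of_nat (k + 1) * bf (n - 2) k"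
proof -
  have odd2: "odd (n - 2)" using assms by auto
  have l: "coeff ([:1, 4:] * p) k = coeff p k + (if k = 0 then 0 else 4 * coeff p (k - 1))" for p :: "rat poly"
    by (simp add: coeff_pCons split: nat.split)
  have "coeff ([:1, 4:] * pderiv (pderiv (bF n)) + smult 6 (pderiv (bF n))) k
      = coeff (smult (of_nat n * of_nat (n - 1)) (bF (n - 2))) k"
    by (simp only: bF_ODE[OF assms])
  then have "(-1) ^ k * (of_nat (k + 1) * (of_nat (k + 2) * bf n (Suc (Suc k)) - of_nat (4 * k + 6) * bf n (Suc k)))
      = (-1) ^ k * (of_nat n * of_nat (n - 1) * bf (n - 2) k)"
    unfolding coeff_add l coeff_smult coeff_pderiv coeff_bF[OF assms(1)] coeff_bF[OF odd2]
    by (cases k) (simp_all add: algebra_simps)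
  then have "of_nat (k + 1) * (of_nat (k + 2) * bf n (Suc (Suc k)) - of_nat (4 * k + 6) * bf n (Suc k))
      = of_nat n * of_nat (n - 1) * bf (n - 2) k"
    by simp
  then show ?thesis
    by (simp add: field_simps del: of_nat_Suc of_nat_add of_nat_mult)
qed

lemma bf_eq_0:
  assumes "odd n" "k \<ge> (n + 1) div 2"
  shows "bf n k = 0"
proof -
  have "degree (bF n) < k" unfolding degree_bF[OF assms(1)] using assms by (auto elim: oddE)
  then show ?thesis using coeff_bF[OF assms(1), of k] by (simp add: coeff_eq_0)
qed

text \<open>The recurrence determines \<open>bf n\<close> from \<open>bf (n - 2)\<close> by descent on the second index, and
  all its terms have the same sign once the factor \<open>(- 1) ^ m\<close> is included.\<close>

lemma bf_sign:
  "0 \<le> (-1) ^ m * bf (2 * m + 1) k \<and> ((k = m \<or> 1 \<le> k \<and> k \<le> m) \<longrightarrow> 0 < (-1) ^ m * bf (2 * m + 1) k)"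
proof (induction m arbitrary: k)
  case 0
  \<comment> \<open>The case \<open>k = m\<close> of the claim adds something only for
    \<open>m = 0\<close>: this positive value makes the leading coefficient positive in the first
    induction step.\<close>
  have "bf 1 0 = 1 / 2"
    using bf_eq_gbinomial_sum[of 1 0] by (simp add: coeff_bernoulli_poly bernoulli_num_small)
  moreover have "bf 1 k = 0" if "k \<noteq> 0"
    using that by (intro bf_eq_0) simp_all
  ultimately show ?case
    by (cases "k = 0") simp_all
next
  case (Suc m)
  let ?n = "2 * Suc m + 1"
  define e where "e k = (-1) ^ Suc m * bf ?n k" for k
  define d where "d k = (-1) ^ m * bf (2 * m + 1) k" for k
  \<comment> \<open>Since \<open>e\<close> carries one more sign than \<open>d\<close>, the
    subtracted term of \<open>bf_recurrence\<close> becomes an added one.\<close>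
  have rec: "e (Suc k) = (of_nat (k + 2) * e (Suc (Suc k)) + of_nat ?n * of_nat (?n - 1) / of_nat (k + 1) * d k)
     / of_nat (4 * k + 6)" for k
  proof -
    define a :: rat where "a = of_nat ?n * of_nat (?n - 1) / of_nat (k + 1)"
    have "of_nat (4 * k + 6) * bf ?n (Suc k) = of_nat (k + 2) * bf ?n (Suc (Suc k)) - a * bf (2 * m + 1) k"
      using bf_recurrence[of ?n k] by (simp add: a_def)
    then have "(-1) ^ Suc m * (of_nat (4 * k + 6) * bf ?n (Suc k))
        = (-1) ^ Suc m * (of_nat (k + 2) * bf ?n (Suc (Suc k)) - a * bf (2 * m + 1) k)"
      by (simp only:)
    then have "of_nat (4 * k + 6) * e (Suc k) = of_nat (k + 2) * e (Suc (Suc k)) + a * d k"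
      unfolding e_def d_def by (simp add: algebra_simps)
    moreover have "of_nat (4 * k + 6) \<noteq> (0 :: rat)" by (simp only: of_nat_eq_0_iff)
    ultimately show ?thesis unfolding a_def[symmetric] by (simp only: eq_divide_eq simp_thms if_True mult.commute)
  qed
  have d: "0 \<le> d k" "k = m \<or> 1 \<le> k \<and> k \<le> m \<Longrightarrow> 0 < d k" for k
    using Suc.IH[of k] unfolding d_def by blast+
  have e0: "e k = 0" if "k > Suc m \<or> k = 0" for k
  proof (cases "k = 0")
    case True
    then show ?thesis
      using coeff_bF_0[of ?n] coeff_bF[of ?n 0] by (simp add: e_def)
  next
    case False
    then show ?thesis using that by (auto simp: e_def intro!: bf_eq_0)
  qed
  \<comment> \<open>Descent in \<open>k\<close>: \<open>e\<close> vanishes beyond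
    \<open>Suc m\<close>, and \<open>rec\<close> has nonnegative coefficients.\<close>
  have nonneg: "0 \<le> e k" for k
  proof (induction "Suc m - k" arbitrary: k)
    case 0
    then have "k \<ge> Suc m" by simp
    then show ?case
      using d(1)[of m] by (cases "k = Suc m") (simp_all add: e0 rec[of m])
  next
    case (Suc j)
    show ?case
    proof (cases k)
      case (Suc i)
      then have "0 \<le> e (Suc k)" using Suc.hyps by simp
      then show ?thesis
        using d(1)[of i] unfolding Suc rec[of i] by simp
    qed (simp add: e0)
  qed
  \<comment> \<open>At the top strictness comes from \<open>d m\<close>; below it, from the value of
    \<open>e\<close> one index higher, as \<open>d i\<close> is only taken to be
    nonnegative.\<close>
  have pos: "0 < e (Suc i)" if "i \<le> m" for i
    using that
  proof (induction i rule: inc_induct)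
    case base
    then show ?case unfolding rec[of m] using d(2)[of m] nonneg[of "Suc (Suc m)"]
      by (intro divide_pos_pos add_nonneg_pos) auto
  next
    case (step i)
    then show ?case unfolding rec[of i] using d(1)[of i]
      by (intro divide_pos_pos add_pos_nonneg) auto
  qed
  have "0 \<le> e k \<and> ((k = Suc m \<or> 1 \<le> k \<and> k \<le> Suc m) \<longrightarrow> 0 < e k)"
    using nonneg[of k] pos[of "k - 1"] by (cases k) auto
  then show ?case unfolding e_def .
qed

section \<open>Power sums and Faulhaber polynomials\<close>

lemma poly_eq_if_pderiv_eq:
  fixes p q :: "rat poly"
  assumes "pderiv p = pderiv q" "poly p 0 = poly q 0"
  shows "p = q"
proof -
  obtain h where "p - q = [:h:]"
    using pderiv_iszero[of "p - q"] assms(1) by (auto simp: pderiv_diff)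
  moreover have "poly (p - q) 0 = 0" using assms(2) by simp
  ultimately show ?thesis by simp
qed

lemma pderiv_power_sum_poly: "pderiv (power_sum_poly n) = bernoulli_poly n"
  by (simp add: power_sum_poly_def pderiv_smult pderiv_diff pderiv_bernoulli_poly)

lemma power_sum_poly_at_0: "poly (power_sum_poly n) 0 = 0"
  by (simp add: power_sum_poly_def bernoulli_num_def)

text \<open>S_n is the antiderivative of B_n that vanishes at 0. This turns equations for S_n into
  equations for B_n.\<close>

lemma power_sum_poly_eq_iff:
  assumes "poly p 0 = 0"
  shows "power_sum_poly n = p \<longleftrightarrow> bernoulli_poly n = pderiv p"
  using poly_eq_if_pderiv_eq[of "power_sum_poly n" p] assms
  by (auto simp: pderiv_power_sum_poly power_sum_poly_at_0)

lemma bernoulli_poly_1_eq: "bernoulli_poly (Suc 0) = [:-1/2, 1:]"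
  by (simp add: bernoulli_poly_altdef bernoulli_num_small monom_0 monom_Suc)

lemma bernoulli_poly_2_eq: "bernoulli_poly 2 = [:1/6, -1, 1:]"
  using bernoulli_num_small
  by (simp add: bernoulli_poly_altdef numeral_2_eq_2 monom_0 monom_Suc)

lemma power_sum_poly_1: "power_sum_poly 1 = [:0, -1/2, 1/2:]"
  by (subst power_sum_poly_eq_iff) (simp_all add: bernoulli_poly_1_eq pderiv_pCons)

lemma power_sum_poly_2: "power_sum_poly 2 = smult (1/6) ([:-1, 2:] * [:0, -1, 1:])"
  by (subst power_sum_poly_eq_iff) (simp_all add: bernoulli_poly_2_eq pderiv_pCons)

lemma power_sum_poly_even:
  assumes "odd n" "n \<ge> 3"
  shows "power_sum_poly (n - 1) = smult (1 / of_nat n) (bernoulli_poly n)"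
  using assms bernoulli_num_odd[of n] by (simp add: power_sum_poly_def)

text \<open>Uniqueness behind the \<open>THE\<close>: the prefactor is nonzero and S_1 is
  nonconstant, so both can be cancelled.\<close>

lemma faulhaber_eqI:
  assumes "n \<ge> 2" "degree F = n div 2 - 1"
    and "power_sum_poly n =
       (if even n then power_sum_poly 2 else (power_sum_poly 1)\<^sup>2) * pcompose F (power_sum_poly 1)"
  shows "faulhaber n = F"
  unfolding faulhaber_def
proof (rule the_equality)
  let ?c = "if even n then power_sum_poly 2 else (power_sum_poly 1)\<^sup>2"
  fix G
  assume "degree G = n div 2 - 1 \<and> power_sum_poly n = ?c * pcompose G (power_sum_poly 1)"
  then have "?c * pcompose G (power_sum_poly 1) = ?c * pcompose F (power_sum_poly 1)"
    using assms(3) by metis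
  moreover have "?c \<noteq> 0" by (simp add: power_sum_poly_1 power_sum_poly_2 del: One_nat_def)
  ultimately have "pcompose G (power_sum_poly 1) = pcompose F (power_sum_poly 1)" by simp
  then show "G = F" by (rule pcompose_inject) (simp add: power_sum_poly_1 del: One_nat_def)
qed (use assms in auto)

text \<open>The change of variable u = 2 y, for rewriting polynomials in u as polynomials in
  y.\<close>

lemma pcompose_smult_2_half: "pcompose (pcompose p [:0, 2:]) [:0, -1/2, 1/2:] = pcompose p [:0, -1, 1 :: rat:]"
  by (simp add: pcompose_assoc[symmetric] pcompose_pCons)

text \<open>Here S_{n-1} = B_n / n = u' F_n(u) / n. Writing F_n(u) = u L(u) and u' u = 6 S_2 shows
  that the Faulhaber polynomial is (6 / n) L(2 y).\<close>

lemma power_sum_poly_even_faulhaber: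
  assumes "odd n" "n \<ge> 3"
  shows "power_sum_poly (n - 1) = power_sum_poly 2 * pcompose (faulhaber (n - 1)) [:0, -1/2, 1/2:]"
proof -
  obtain c L where "bF n = pCons c L" by (cases "bF n")
  then have L: "bF n = pCons 0 L" using coeff_bF_0[of n] assms by auto
  then have "L \<noteq> 0" using degree_bF[of n] assms by auto
  then have degL: "degree L = (n - 1) div 2 - 1" using degree_bF[of n] assms L by simp
  let ?F = "smult (6 / of_nat n) (pcompose L [:0, 2:])"
  have eq: "power_sum_poly (n - 1) = power_sum_poly 2 * pcompose ?F [:0, -1/2, 1/2:]"
    unfolding power_sum_poly_even[OF assms] bernoulli_poly_odd_eq_bF[OF assms(1)] L
      power_sum_poly_2 pcompose_smult pcompose_smult_2_half
    using assms by (simp add: pcompose_pCons mult_ac del: mult_pCons_left mult_pCons_right)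
  have "faulhaber (n - 1) = ?F"
    using assms degL eq power_sum_poly_1 by (intro faulhaber_eqI) (auto simp: degree_pcompose)
  with eq show ?thesis by simp
qed

text \<open>S_n is symmetric about 1/2, so S_n = G(u) with G' = \<open>bF n\<close>. Both G and G'
  vanish at 0, whence G(u) = u^2 K(u), and u^2 = 4 y^2 gives the Faulhaber polynomial 4 K(2
  y).\<close>

lemma power_sum_poly_odd_faulhaber:
  assumes "odd n" "n \<ge> 3"
  shows "power_sum_poly n = [:0, -1/2, 1/2:]\<^sup>2 * pcompose (faulhaber n) [:0, -1/2, 1/2:]"
proof -
  let ?u = "[:0, -1, 1:] :: rat poly"
  have "pcompose (power_sum_poly n) [:1, -1:] = power_sum_poly n"
    using assms by (simp add: power_sum_poly_def pcompose_smult pcompose_diff bernoulli_poly_reflect)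
  then obtain G where G: "power_sum_poly n = pcompose G ?u"
    using symmetric_poly_imp_pcompose by blast
  have G0: "coeff G 0 = 0"
    using power_sum_poly_at_0[of n] by (simp add: G poly_pcompose poly_0_coeff_0)
  have "[:-1, 2:] * pcompose (pderiv G) ?u = [:-1, 2:] * pcompose (bF n) ?u"
    using pderiv_power_sum_poly[of n]
    unfolding G bernoulli_poly_odd_eq_bF[OF assms(1)] pderiv_pcompose
    by (simp add: pderiv_pCons mult.commute del: mult_pCons_left mult_pCons_right)
  then have "pcompose (pderiv G) ?u = pcompose (bF n) ?u"
    by (simp only: mult_cancel_left) simp
  then have G': "pderiv G = bF n"
    by (rule pcompose_inject) simp
  have G1: "coeff G 1 = 0"
    using coeff_bF_0[of n] assms by (simp add: G'[symmetric] coeff_pderiv)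
  obtain a b K where "G = pCons a (pCons b K)" by (metis pCons_cases)
  then have K: "G = pCons 0 (pCons 0 K)" using G0 G1 by simp
  have degG: "degree G - 1 = (n - 1) div 2"
    using degree_pderiv[of G] by (simp add: G' degree_bF[OF assms(1)])
  then have "K \<noteq> 0" using assms K by auto
  then have degK: "degree K = n div 2 - 1" using degG K assms by (auto elim!: oddE)
  let ?F = "smult 4 (pcompose K [:0, 2:])"
  have uu: "?u * ?u = smult 4 ([:0, -1/2, 1/2:]\<^sup>2)" by (simp add: power2_eq_square)
  have "pcompose G ?u = (?u * ?u) * pcompose K ?u"
    unfolding K pcompose_pCons by (simp only: pCons_0_0 add_0 mult.assoc)
  then have eq: "power_sum_poly n = [:0, -1/2, 1/2:]\<^sup>2 * pcompose ?F [:0, -1/2, 1/2:]"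
    unfolding pcompose_smult pcompose_smult_2_half G uu
    by (simp only: mult_smult_left mult_smult_right)
  have "faulhaber n = ?F"
    using assms degK eq power_sum_poly_1 by (intro faulhaber_eqI) (auto simp: degree_pcompose)
  with eq show ?thesis by simp
qed

section \<open>Derivatives of the reciprocal Bernoulli polynomials\<close>

text \<open>The falling factorial of the exponent is written as k! times a binomial coefficient.
  Agreement on the open half-line suffices for the derivatives there.\<close>

lemma higher_deriv_sum_powi:
  fixes f :: "real \<Rightarrow> real"
  assumes "\<And>x. x > 0 \<Longrightarrow> f x = (\<Sum>i\<in>A. c i * x powi m i)" and "x > 0"
  shows "(deriv ^^ k) f x = (\<Sum>i\<in>A. c i * (fact k * (of_int (m i) gchoose k)) * x powi (m i - int k))"
  using assms(2)
proof (induction k arbitrary: x)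
  case 0
  then show ?case by (simp add: assms(1))
next
  case (Suc k)
  have g: "fact (Suc k) * (a gchoose Suc k) = fact k * (a gchoose k) * (a - of_nat k)" for a :: real
    unfolding gbinomial_mult_fact by simp
  have "((\<lambda>x. \<Sum>i\<in>A. c i * (fact k * (of_int (m i) gchoose k)) * x powi (m i - int k)) has_real_derivative
     (\<Sum>i\<in>A. c i * (fact (Suc k) * (of_int (m i) gchoose Suc k)) * x powi (m i - int (Suc k)))) (at x)"
    unfolding g using Suc.prems by (auto intro!: derivative_eq_intros sum.cong simp: algebra_simps)
  then have "((deriv ^^ k) f has_real_derivative
     (\<Sum>i\<in>A. c i * (fact (Suc k) * (of_int (m i) gchoose Suc k)) * x powi (m i - int (Suc k)))) (at x)"
    by (rule has_field_derivative_transform_within_open[of _ _ _ "{0<..}"]) (use Suc in auto)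
  then show ?case by (simp add: DERIV_imp_deriv)
qed

lemma of_rat_gbinomial: "of_rat (a gchoose k) = (of_rat a gchoose k :: real)"
proof -
  have "of_rat (fact k) = (fact k :: real)"
    using of_rat_of_nat_eq[of "fact k"] by simp
  then show ?thesis
    by (simp add: gbinomial_prod_rev of_rat_divide of_rat_prod of_rat_diff)
qed

text \<open>At x = 1 all powers of x equal 1, and what is left is k! times the sum in
  \<open>bf_eq_gbinomial_sum\<close>.\<close>

lemma bf_eq_higher_deriv:
  "of_rat (bf n k) = 1 / fact k * (deriv ^^ k) (recip_bernoulli n (2 * int k)) 1"
proof -
  have "recip_bernoulli n (2 * int k) x
     = (\<Sum>i\<le>n. of_rat (coeff (bernoulli_poly n) i) * x powi (2 * int k - int i))" if "x > 0" for x
    using that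
    by (simp add: recip_bernoulli_def poly_altdef degree_map_poly degree_bernoulli_poly coeff_map_poly
        sum_distrib_left power_int_diff field_simps)
  from higher_deriv_sum_powi[OF this, of 1 k] show ?thesis
    by (simp add: bf_eq_gbinomial_sum of_rat_sum of_rat_mult of_rat_gbinomial of_rat_diff sum_distrib_left)
qed

section \<open>Division by x - 1/2 and the equivalences\<close>

text \<open>Clearing the denominator 2 (x - 1/2) = 2 x - 1 in the field of fractions, into which
  \<open>to_fract\<close> embeds the polynomials.\<close>

lemma fract_eq_iff_bernoulli:
  "(1/2) * (to_fract p / to_fract [:- 1/2, 1:]) = to_fract q \<longleftrightarrow> p = [:-1, 2:] * (q :: rat poly)"
proof -
  have "(1/2) * (a / d) = b \<longleftrightarrow> a = (d + d) * b" if "d \<noteq> 0" "(2 :: rat poly fract) \<noteq> 0"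
    for a b d :: "rat poly fract"
    using that by (auto simp: field_simps)
  moreover have "to_fract (1 + 1 :: rat poly) \<noteq> 0" by (simp only: to_fract_eq_0_iff)
  then have "(2 :: rat poly fract) \<noteq> 0" by (simp only: to_fract_add to_fract_1 one_add_one)
  ultimately have "(1/2) * (to_fract p / to_fract [:- 1/2, 1:]) = to_fract q
      \<longleftrightarrow> to_fract p = (to_fract [:- 1/2, 1:] + to_fract [:- 1/2, 1:]) * to_fract q"
    by simp
  also have "to_fract [:- 1/2, 1:] + to_fract [:- 1/2, 1:] = to_fract [:-1, 2 :: rat:]"
    by (simp only: to_fract_add[symmetric]) simp
  also have "to_fract p = to_fract [:-1, 2:] * to_fract q \<longleftrightarrow> p = [:-1, 2:] * q"
    by (simp only: to_fract_mult[symmetric] to_fract_eq_iff)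
  finally show ?thesis .
qed

text \<open>In the equivalences \<open>F\<close> and \<open>G\<close> are arbitrary, and H(u) is
  what remains of the derivative of y^2 F(y), respectively of (n/3) (y^2)' G(y), after division by
  u'.\<close>

theorem theorem10p5:
  fixes n :: nat and y u :: "rat poly"
  assumes n: "n \<ge> 3" "odd n"
    and y: "y = [:0, - 1/2, 1/2:]"
    and u: "u = [:0, - 1, 1:]"
  shows
    "(\<forall>F H. pcompose H u = y * pcompose F y + smult (1/2) (y\<^sup>2 * pcompose (pderiv F) y) \<longrightarrow>
       (power_sum_poly n = y\<^sup>2 * pcompose F y \<longleftrightarrow>
          (1/2) * (to_fract (bernoulli_poly n) / to_fract [:- 1/2, 1:]) = to_fract (pcompose H u)) \<and>
       (power_sum_poly n = y\<^sup>2 * pcompose F y \<longleftrightarrow>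
          bernoulli_poly n = pderiv u * pcompose H u)) \<and>
     (\<forall>G H. pcompose H u = smult (of_nat n / 3) (y * pcompose G y) \<longrightarrow>
       (power_sum_poly (n - 1) = smult (1/3) (pderiv (y\<^sup>2)) * pcompose G y \<longleftrightarrow>
          (1/2) * (to_fract (bernoulli_poly n) / to_fract [:- 1/2, 1:]) = to_fract (pcompose H u)) \<and>
       (power_sum_poly (n - 1) = smult (1/3) (pderiv (y\<^sup>2)) * pcompose G y \<longleftrightarrow>
          bernoulli_poly n = pderiv u * pcompose H u)) \<and>
     (pcompose (bF n) u =
       y * pcompose (faulhaber n) y + smult (1/2) (y\<^sup>2 * pcompose (pderiv (faulhaber n)) y)) \<and>
     (pcompose (bF n) u = smult (of_nat n / 3) (y * pcompose (faulhaber (n - 1)) y)) \<and>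
     (power_sum_poly n = y\<^sup>2 * pcompose (faulhaber n) y) \<and>
     (power_sum_poly (n - 1) = smult (1/3) (pderiv (y\<^sup>2)) * pcompose (faulhaber (n - 1)) y) \<and>
     ((1/2) * (to_fract (bernoulli_poly n) / to_fract [:- 1/2, 1:]) = to_fract (pcompose (bF n) u)) \<and>
     (bernoulli_poly n = pderiv u * pcompose (bF n) u) \<and>
     (\<forall>k. coeff (bF n) k = (- 1) ^ k * bf n k) \<and>
     (\<forall>k. of_rat (bf n k) = 1 / fact k * (deriv ^^ k) (recip_bernoulli n (2 * int k)) 1) \<and>
     (\<forall>k\<le>n. bf n k = (\<Sum>\<nu>=0..k. (of_int (2 * int k - int n) gchoose (k - \<nu>)) * frakB_num n \<nu>)) \<and>
     (\<forall>k\<le>n. bf n k =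
       - (\<Sum>\<nu>=0..k. of_nat ((2 * k - \<nu>) choose k) * of_nat (n choose \<nu>) * bernoulli_num (n - \<nu>))) \<and>
     (bf n 0 = 0) \<and>
     (\<forall>k\<ge>(n + 1) div 2. bf n k = 0) \<and>
     (\<forall>k. 1 \<le> k \<and> k \<le> (n - 1) div 2 \<longrightarrow> (- 1) ^ ((n - 1) div 2) * bf n k > 0) \<and>
     (degree (bF n) = (n - 1) div 2) \<and>
     (poly (bF n) 0 = 0)"
proof -
  let ?v = "[:-1, 2:] :: rat poly"
  have n2: "odd n" "n \<noteq> 1" using n by auto
  have u': "pderiv u = ?v" and y': "pderiv y = smult (1/2) ?v"
    by (simp_all add: u y pderiv_pCons)
  have y0: "poly y 0 = 0" by (simp add: y)
  have v_cancel: "?v * p = ?v * q \<longleftrightarrow> p = q" for p q :: "rat poly"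
    by (simp only: mult_cancel_left) simp
  note fract_iff = fract_eq_iff_bernoulli[of "bernoulli_poly n"]
  have h: "smult (1/2) p + smult (1/2) p = p" for p :: "rat poly"
    by (simp flip: smult_add_left)
  have yy': "pderiv (y\<^sup>2) = ?v * y"
    unfolding power2_eq_square pderiv_mult y' mult_smult_right h by (rule mult.commute)
  \<comment> \<open>Differentiation with y' = u' / 2: the two equal halves come from (y^2)' = 2 y
    y'.\<close>
  have odd_iff: "power_sum_poly n = y\<^sup>2 * pcompose F y \<longleftrightarrow>
      bernoulli_poly n = ?v * (y * pcompose F y + smult (1/2) (y\<^sup>2 * pcompose (pderiv F) y))" for F
  proof -
    define v where "v = ?v"
    have "pderiv (y\<^sup>2 * pcompose F y) = ?v * ((smult (1/2) (y * pcompose F y) + smult (1/2) (y * pcompose F y))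
        + smult (1/2) (y\<^sup>2 * pcompose (pderiv F) y))"
      unfolding power2_eq_square pderiv_mult pderiv_pcompose y' v_def[symmetric]
      by (simp add: algebra_simps smult_add_right)
    then show ?thesis
      using y0 by (subst power_sum_poly_eq_iff) (simp_all only: h, simp)
  qed
  have even_iff: "power_sum_poly (n - 1) = smult (1/3) (pderiv (y\<^sup>2)) * pcompose G y \<longleftrightarrow>
      bernoulli_poly n = ?v * smult (of_nat n / 3) (y * pcompose G y)" for G
  proof -
    have "smult (of_nat n) (smult (1/3) (pderiv (y\<^sup>2)) * pcompose G y)
        = ?v * smult (of_nat n / 3) (y * pcompose G y)"
      unfolding yy' by (simp only: mult_smult_left mult_smult_right smult_smult mult.assoc) simp
    moreover have "power_sum_poly (n - 1) = p \<longleftrightarrow> bernoulli_poly n = smult (of_nat n) p" for p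
      unfolding power_sum_poly_even[OF n(2,1)] using n(1) by auto
    ultimately show ?thesis by simp
  qed
  have B: "bernoulli_poly n = ?v * pcompose (bF n) u"
    using bernoulli_poly_odd_eq_bF[OF n(2)] u by simp
  have S_odd: "power_sum_poly n = y\<^sup>2 * pcompose (faulhaber n) y"
    using power_sum_poly_odd_faulhaber[OF n(2,1)] y by simp
  have "power_sum_poly 2 = smult (1/3) (pderiv (y\<^sup>2))"
    by (simp add: power_sum_poly_2 y power2_eq_square pderiv_pCons)
  then have S_even: "power_sum_poly (n - 1) = smult (1/3) (pderiv (y\<^sup>2)) * pcompose (faulhaber (n - 1)) y"
    using power_sum_poly_even_faulhaber[OF n(2,1)] y by simp
  show ?thesis
  proof (intro conjI allI impI)
    \<comment> \<open>Times u', both sides equal B_n; cancelling u' leaves the claim.\<close>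
    show "pcompose (bF n) u =
        y * pcompose (faulhaber n) y + smult (1/2) (y\<^sup>2 * pcompose (pderiv (faulhaber n)) y)"
      by (rule iffD1[OF v_cancel]) (use S_odd B in \<open>simp only: odd_iff\<close>)
    show "pcompose (bF n) u = smult (of_nat n / 3) (y * pcompose (faulhaber (n - 1)) y)"
      by (rule iffD1[OF v_cancel]) (use S_even B in \<open>simp only: even_iff\<close>)
    show "poly (bF n) 0 = 0" "bf n 0 = 0"
      using coeff_bF_0[OF n2(1,2)] coeff_bF[OF n(2), of 0] by (simp_all add: poly_0_coeff_0)
    show "0 < (-1) ^ ((n - 1) div 2) * bf n k" if "1 \<le> k \<and> k \<le> (n - 1) div 2" for k
      using bf_sign[of "(n - 1) div 2" k] that n(2) by (auto elim!: oddE)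
    show "degree (bF n) = (n - 1) div 2" by (rule degree_bF[OF n(2)])
    show "bf n k = 0" if "(n + 1) div 2 \<le> k" for k by (rule bf_eq_0[OF n(2) that])
    show "bf n k = (\<Sum>\<nu>=0..k. (of_int (2 * int k - int n) gchoose (k - \<nu>)) * frakB_num n \<nu>)" for k
      by (rule bf_eq_frakB_num_sum)
    show "bf n k =
       - (\<Sum>\<nu>=0..k. of_nat ((2 * k - \<nu>) choose k) * of_nat (n choose \<nu>) * bernoulli_num (n - \<nu>))"
      if "k \<le> n" for k
      by (rule bf_eq_bernoulli_num_sum[OF n(2) that])
    show "of_rat (bf n k) = 1 / fact k * (deriv ^^ k) (recip_bernoulli n (2 * int k)) 1" for k
      by (rule bf_eq_higher_deriv)
    show "coeff (bF n) k = (- 1) ^ k * bf n k" for k by (rule coeff_bF[OF n(2)])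
    show "power_sum_poly n = y\<^sup>2 * pcompose (faulhaber n) y" by (rule S_odd)
    show "power_sum_poly (n - 1) = smult (1/3) (pderiv (y\<^sup>2)) * pcompose (faulhaber (n - 1)) y"
      by (rule S_even)
    show "bernoulli_poly n = pderiv u * pcompose (bF n) u" unfolding u' by (rule B)
    show "(1/2) * (to_fract (bernoulli_poly n) / to_fract [:- 1/2, 1:]) = to_fract (pcompose (bF n) u)"
      unfolding fract_iff by (rule B)
  \<comment> \<open>The remaining equivalences all reduce to B_n = u' H(u) once H(u) is replaced by
    its prescribed value.\<close>
  qed (simp_all only: odd_iff even_iff fract_iff u')
qed

end
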